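(* Let $G$ be a countable amenable group with decidable word problem, let $H\le G$ be an infinite subgroup with decidable word problem, and let $\iota\colon H\hookrightarrow G$ be the inclusion. Then there exists an effective $H$-subshift $X$ such that the induced $G$-subshift $\iota_*(X)$ is not sofic.
   Context: For a group $G$ and a finite set $A$, $G$ acts on $A^G$ by $(gx)(h)=x(hg)$. A subshift (or $G$-subshift) is a closed (product topology) $G$-invariant subset of $A^G$. A pattern is an element $p\in A^F$ with $F\subseteq G$ finite, and $S_p=\{x\in A^G: (gx)|_F\neq p\ \forall g\in G\}$. An SFT (subshift of finite type) is a finite intersection of sets $S_p$. A sofic shift $X\subseteq A^G$ is the image of an SFT $Y\subseteq B^G$ ($B$ finite) under the map $B^G\to A^G$ applying a map $B\to A$ at each coordinate. An effective subshift is an intersection of sets $S_p$ for $p$ ranging over a recursively enumerable sequence of patterns; here the group is identified with a computable copy of itself (a bijection with an initial segment of $\mathbb N$ making the multiplication computable). For a subgroup inclusion $\iota\colon H\hookrightarrow G$ and an $H$-subshift $X\subseteq A^H$, the induced $G$-subshift is $\iota_*(X)=\{y\in A^G : \text{for all } g\in G,\ (h\mapsto y(hg))\in X\}$. *)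

theory Defs
  imports
    "HOL-Algebra.Coset"
    "HOL-Analysis.Function_Topology"
    "HOL-Library.Nat_Bijection"
    "HOL-Library.Countable_Set"
begin

section \<open>Computability\<close>

text \<open>
  \<open>recursive_fun n f\<close>: the restriction of \<open>f\<close> to lists of length \<open>n\<close> is a total recursive
  function of \<open>n\<close> arguments. Minimisation is only applied to regular functions, which suffices to
  obtain all total recursive functions. By rule \<open>cong\<close>, the values of \<open>f\<close> on lists of other
  lengths are irrelevant.
\<close>

inductive recursive_fun :: "nat \<Rightarrow> (nat list \<Rightarrow> nat) \<Rightarrow> bool" where
  zero: "recursive_fun n (\<lambda>xs. 0)"
| succ: "recursive_fun 1 (\<lambda>xs. Suc (xs ! 0))"
| proj: "i < n \<Longrightarrow> recursive_fun n (\<lambda>xs. xs ! i)"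
| comp: "recursive_fun (length gs) f \<Longrightarrow> (\<forall>g\<in>set gs. recursive_fun n g) \<Longrightarrow>
    recursive_fun n (\<lambda>xs. f (map (\<lambda>g. g xs) gs))"
| prim_rec: "recursive_fun n f \<Longrightarrow> recursive_fun (Suc (Suc n)) g \<Longrightarrow>
    recursive_fun (Suc n) (\<lambda>xs. rec_nat (f (tl xs)) (\<lambda>y r. g (y # r # tl xs)) (hd xs))"
| minim: "recursive_fun (Suc n) f \<Longrightarrow> (\<forall>xs. length xs = n \<longrightarrow> (\<exists>y. f (y # xs) = 0)) \<Longrightarrow>
    recursive_fun n (\<lambda>xs. LEAST y. f (y # xs) = 0)"
| cong: "recursive_fun n f \<Longrightarrow> (\<forall>xs. length xs = n \<longrightarrow> g xs = f xs) \<Longrightarrow> recursive_fun n g"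

definition recursively_enumerable :: "nat set \<Rightarrow> bool" where
  "recursively_enumerable W \<longleftrightarrow>
    W = {} \<or> (\<exists>f. recursive_fun 1 f \<and> W = range (\<lambda>n. f [n]))"


section \<open>Groups\<close>

definition computable_copy :: "('g, 'm) monoid_scheme \<Rightarrow> ('g \<Rightarrow> nat) \<Rightarrow> bool" where
  "computable_copy G \<nu> \<longleftrightarrow>
    (\<exists>I. (I = UNIV \<or> (\<exists>n. I = {..<n})) \<and> bij_betw \<nu> (carrier G) I) \<and>
    (\<exists>m. recursive_fun 2 m \<and>
      (\<forall>g\<in>carrier G. \<forall>h\<in>carrier G. m [\<nu> g, \<nu> h] = \<nu> (g \<otimes>\<^bsub>G\<^esub> h)))"

text \<open>
  The groups considered need not be finitely generated, so decidability of the word problem means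
  that the group has a computable copy; for finitely generated groups this is equivalent to
  decidability of the set of words in the generators that represent the identity.
\<close>

definition decidable_word_problem :: "('g, 'm) monoid_scheme \<Rightarrow> bool" where
  "decidable_word_problem G \<longleftrightarrow> (\<exists>\<nu>. computable_copy G \<nu>)"

text \<open>Amenability of a discrete group, in terms of Foelner sets.\<close>

definition amenable :: "('g, 'm) monoid_scheme \<Rightarrow> bool" where
  "amenable G \<longleftrightarrow>
    (\<forall>K \<epsilon>. finite K \<and> K \<subseteq> carrier G \<and> (\<epsilon>::real) > 0 \<longrightarrow>
      (\<exists>F. finite F \<and> F \<noteq> {} \<and> F \<subseteq> carrier G \<and>
        (\<forall>g\<in>K. real (card (sym_diff (g <#\<^bsub>G\<^esub> F) F)) \<le> \<epsilon> * real (card F))))"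


section \<open>Subshifts\<close>

text \<open>Configurations are functions on the carrier, extended by \<open>undefined\<close>.\<close>

definition configs :: "('g, 'm) monoid_scheme \<Rightarrow> 'a set \<Rightarrow> ('g \<Rightarrow> 'a) set" where
  "configs G A = (carrier G \<rightarrow>\<^sub>E A)"

definition shift :: "('g, 'm) monoid_scheme \<Rightarrow> 'g \<Rightarrow> ('g \<Rightarrow> 'a) \<Rightarrow> 'g \<Rightarrow> 'a" where
  "shift G g x = (\<lambda>h\<in>carrier G. x (h \<otimes>\<^bsub>G\<^esub> g))"

definition subshift :: "('g, 'm) monoid_scheme \<Rightarrow> 'a set \<Rightarrow> ('g \<Rightarrow> 'a) set \<Rightarrow> bool" where
  "subshift G A X \<longleftrightarrow> finite A \<and>
    closedin (product_topology (\<lambda>_. discrete_topology A) (carrier G)) X \<and>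
    (\<forall>g\<in>carrier G. \<forall>x\<in>X. shift G g x \<in> X)"

text \<open>A pattern in \<open>A\<^sup>F\<close> is a partial function with domain \<open>F\<close>.\<close>

definition pattern :: "('g, 'm) monoid_scheme \<Rightarrow> 'a set \<Rightarrow> ('g \<rightharpoonup> 'a) \<Rightarrow> bool" where
  "pattern G A p \<longleftrightarrow> finite (dom p) \<and> dom p \<subseteq> carrier G \<and> ran p \<subseteq> A"

definition avoiding :: "('g, 'm) monoid_scheme \<Rightarrow> 'a set \<Rightarrow> ('g \<rightharpoonup> 'a) \<Rightarrow> ('g \<Rightarrow> 'a) set" where
  "avoiding G A p =
    {x \<in> configs G A. \<forall>g\<in>carrier G. (Some \<circ> shift G g x) |` dom p \<noteq> p}"

text \<open>Intersecting with \<open>configs G A\<close> makes the empty intersection the full shift.\<close>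

definition SFT :: "('g, 'm) monoid_scheme \<Rightarrow> 'a set \<Rightarrow> ('g \<Rightarrow> 'a) set \<Rightarrow> bool" where
  "SFT G A X \<longleftrightarrow> finite A \<and>
    (\<exists>P. finite P \<and> (\<forall>p\<in>P. pattern G A p) \<and> X = configs G A \<inter> (\<Inter>p\<in>P. avoiding G A p))"

text \<open>
  Up to renaming of symbols, every finite alphabet is a finite set of natural numbers; this is
  used for the alphabet \<open>B\<close> here and for the coding of patterns below.
\<close>

definition sofic :: "('g, 'm) monoid_scheme \<Rightarrow> 'a set \<Rightarrow> ('g \<Rightarrow> 'a) set \<Rightarrow> bool" where
  "sofic G A X \<longleftrightarrow> finite A \<and>
    (\<exists>(B :: nat set) Y \<phi>. finite B \<and> SFT G B Y \<and> \<phi> \<in> B \<rightarrow> A \<and>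
      X = (\<lambda>y. \<lambda>g\<in>carrier G. \<phi> (y g)) ` Y)"

text \<open>
  A number codes a list of pairs (number of a group element, symbol), read as a partial function.
  If an element occurs repeatedly, its first symbol counts; numbers that do not belong to group
  elements (possible for finite groups only) are ignored.
\<close>

definition coded_pattern ::
    "('g, 'm) monoid_scheme \<Rightarrow> ('g \<Rightarrow> nat) \<Rightarrow> nat \<Rightarrow> ('g \<rightharpoonup> nat)" where
  "coded_pattern G \<nu> c = (map_of (map prod_decode (list_decode c)) \<circ> \<nu>) |` carrier G"

definition effective_subshift ::
    "('g, 'm) monoid_scheme \<Rightarrow> ('g \<Rightarrow> nat) \<Rightarrow> nat set \<Rightarrow> ('g \<Rightarrow> nat) set \<Rightarrow> bool" where
  "effective_subshift G \<nu> A X \<longleftrightarrow> subshift G A X \<and>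
    (\<exists>W. recursively_enumerable W \<and> (\<forall>c\<in>W. pattern G A (coded_pattern G \<nu> c)) \<and>
      X = configs G A \<inter> (\<Inter>c\<in>W. avoiding G A (coded_pattern G \<nu> c)))"

definition induced_subshift ::
    "('g, 'm) monoid_scheme \<Rightarrow> 'g set \<Rightarrow> 'a set \<Rightarrow> ('g \<Rightarrow> 'a) set \<Rightarrow> ('g \<Rightarrow> 'a) set" where
  "induced_subshift G H A X =
    {y \<in> configs G A. \<forall>g\<in>carrier G. (\<lambda>h\<in>H. y (h \<otimes>\<^bsub>G\<^esub> g)) \<in> X}"

text \<open>
  Every set defined by forbidden patterns is a subshift, so the first conjunct in the definition
  of \<open>effective_subshift\<close> only amounts to finiteness of the alphabet.
\<close>

lemma avoiding_alt:
  assumes "pattern G A p"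
  shows "avoiding G A p = {x \<in> configs G A. \<forall>g\<in>carrier G. \<exists>h\<in>dom p. Some (x (h \<otimes>\<^bsub>G\<^esub> g)) \<noteq> p h}"
proof -
  have "((Some \<circ> shift G g x) |` dom p \<noteq> p) \<longleftrightarrow> (\<exists>h\<in>dom p. Some (x (h \<otimes>\<^bsub>G\<^esub> g)) \<noteq> p h)" for g x
  proof -
    have "((Some \<circ> shift G g x) |` dom p) h = (if h \<in> dom p then Some (x (h \<otimes>\<^bsub>G\<^esub> g)) else None)" for h
      using assms by (auto simp: restrict_map_def shift_def pattern_def)
    then show ?thesis by (auto simp: fun_eq_iff) (metis domIff)
  qed
  then show ?thesis by (simp add: avoiding_def)
qed

lemma subshift_avoiding:
  assumes G: "group G" and A: "finite A" and P: "\<forall>p\<in>P. pattern G A p"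
  shows "subshift G A (configs G A \<inter> (\<Inter>p\<in>P. avoiding G A p))"
proof -
  interpret group G by fact
  let ?T = "product_topology (\<lambda>_. discrete_topology A) (carrier G)"
  have top: "topspace ?T = configs G A" by (simp add: configs_def)
  have cyl: "closedin ?T {x \<in> configs G A. Some (x k) \<noteq> s}" if "k \<in> carrier G" for k s
  proof -
    have "closedin ?T {x \<in> topspace ?T. x k \<in> {a \<in> A. Some a \<noteq> s}}"
      using continuous_map_product_projection[OF that, of "\<lambda>_. discrete_topology A"]
      by (rule closedin_continuous_map_preimage) auto
    moreover have "{x \<in> topspace ?T. x k \<in> {a \<in> A. Some a \<noteq> s}} = {x \<in> configs G A. Some (x k) \<noteq> s}"
      using that unfolding top configs_def by (auto simp: PiE_def Pi_def)
    ultimately show ?thesis by simp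
  qed
  have one: "closedin ?T (avoiding G A p)" if p: "pattern G A p" for p
  proof -
    have "avoiding G A p =
        (\<Inter>g\<in>carrier G. \<Union>h\<in>dom p. {x \<in> configs G A. Some (x (h \<otimes>\<^bsub>G\<^esub> g)) \<noteq> p h})"
      unfolding avoiding_alt[OF p] by auto
    moreover have "closedin ?T \<dots>"
    proof (rule closedin_INT)
      show "carrier G \<noteq> {}" by blast
      fix g assume "g \<in> carrier G"
      with p show "closedin ?T (\<Union>h\<in>dom p. {x \<in> configs G A. Some (x (h \<otimes>\<^bsub>G\<^esub> g)) \<noteq> p h})"
        by (intro closedin_Union) (auto simp: pattern_def intro!: cyl)
    qed
    ultimately show ?thesis by simp
  qed
  have closed: "closedin ?T (configs G A \<inter> (\<Inter>p\<in>P. avoiding G A p))"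
  proof (cases "P = {}")
    case True
    then show ?thesis using closedin_topspace[of ?T] top by simp
  next
    case False
    then show ?thesis
      using one P closedin_topspace[of ?T] top
      by (metis closedin_INT closedin_Int)
  qed
  have conf: "shift G g x \<in> configs G A" if "g \<in> carrier G" "x \<in> configs G A" for g x
    using that by (auto simp: configs_def shift_def)
  have inv: "shift G g x \<in> avoiding G A p"
    if "g \<in> carrier G" "x \<in> avoiding G A p" "p \<in> P" for g x p
  proof -
    have p: "pattern G A p" using P that by blast
    then have d: "dom p \<subseteq> carrier G" by (simp add: pattern_def)
    have "\<exists>h\<in>dom p. Some (shift G g x (h \<otimes>\<^bsub>G\<^esub> k)) \<noteq> p h" if k: "k \<in> carrier G" for k
    proof -
      from k \<open>g \<in> carrier G\<close> have "k \<otimes>\<^bsub>G\<^esub> g \<in> carrier G" by simp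
      with \<open>x \<in> avoiding G A p\<close> obtain h where h: "h \<in> dom p" "Some (x (h \<otimes>\<^bsub>G\<^esub> (k \<otimes>\<^bsub>G\<^esub> g))) \<noteq> p h"
        unfolding avoiding_alt[OF p] by blast
      then show ?thesis
        using d k \<open>g \<in> carrier G\<close> by (intro bexI[of _ h]) (auto simp: shift_def m_assoc)
    qed
    then show ?thesis
      using conf that unfolding avoiding_alt[OF p] by blast
  qed
  show ?thesis
    using A closed conf inv by (auto simp: subshift_def)
qed

end

theory Submission
  imports Defs
begin

text \<open>
  Use the symbols 0 to 4, and forbid that for some \<open>a\<close> and \<open>h, k \<in> H\<close> the marker 3 is at \<open>a\<close>, the
  marker 4 at \<open>k a\<close>, the symbol 1 at \<open>h a\<close> and the symbol 2 at \<open>h k a\<close>: around the marker 4 the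
  symbol 2 denies the symbol 1 at the corresponding place around the marker 3. Then the set of 1s of a
  pattern on a finite set \<open>F\<close> can be pinned down by markers and symbols 2 outside \<open>F\<close>, so the \<open>2\<^bsup>|F|\<^esup>\<close>
  patterns over 0 and 1 on \<open>F\<close> have pairwise different extensions, also in the induced subshift of
  \<open>G\<close>. In a sofic shift, however, the set of possible extensions of a pattern on \<open>F\<close> depends only on
  a preimage along the boundary of \<open>F\<close>, and for a Foelner set there are fewer than \<open>2\<^bsup>|F|\<^esup>\<close> boundary
  patterns.
\<close>

section \<open>Recursive functions\<close>

lemma recursive_comp1:
  assumes "recursive_fun 1 f" "recursive_fun n g"
  shows "recursive_fun n (\<lambda>xs. f [g xs])"
  using recursive_fun.comp[of "[g]" f n] assms by simp

lemma recursive_comp2: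
  assumes "recursive_fun 2 f" "recursive_fun n g" "recursive_fun n h"
  shows "recursive_fun n (\<lambda>xs. f [g xs, h xs])"
  using recursive_fun.comp[of "[g, h]" f n] assms by (simp add: numeral_2_eq_2)

lemma recursive_comp3:
  assumes "recursive_fun 3 f" "recursive_fun n g" "recursive_fun n h" "recursive_fun n k"
  shows "recursive_fun n (\<lambda>xs. f [g xs, h xs, k xs])"
  using recursive_fun.comp[of "[g, h, k]" f n] assms by (simp add: numeral_3_eq_3)

lemma recursive_Suc:
  assumes "recursive_fun n f"
  shows "recursive_fun n (\<lambda>xs. Suc (f xs))"
  using recursive_comp1[OF recursive_fun.succ assms] by simp

lemma recursive_const: "recursive_fun n (\<lambda>xs. c)"
  by (induction c) (auto intro: recursive_fun.zero recursive_Suc)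

lemma length_2_3_cases:
  "length xs = 2 \<longleftrightarrow> (\<exists>a b. xs = [a, b])" "length xs = 3 \<longleftrightarrow> (\<exists>a b c. xs = [a, b, c])"
  by (auto simp: numeral_2_eq_2 numeral_3_eq_3 length_Suc_conv)

text \<open>\<open>prim_rec\<close> recurses on the head of the argument list, and its step function
  sees the predecessor at index 0, the recursive value at index 1 and the parameters from index 2
  on. Here, as for the operations below, the function of bare arguments is built first and then
  composed with arbitrary recursive functions, so that the closure rules chain.\<close>

lemma recursive_add:
  assumes "recursive_fun n f" "recursive_fun n g"
  shows "recursive_fun n (\<lambda>xs. f xs + g xs)"
proof -
  have "recursive_fun 2
      (\<lambda>xs. rec_nat (tl xs ! 0) (\<lambda>y r. Suc ((y # r # tl xs) ! 1)) (hd xs))"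
    using recursive_fun.prim_rec[of 1 "\<lambda>xs. xs ! 0" "\<lambda>xs. Suc (xs ! 1)"]
    by (simp add: recursive_fun.proj recursive_Suc numeral_2_eq_2)
  moreover have "rec_nat b (\<lambda>y r. Suc r) a = a + b" for a b :: nat
    by (induction a) auto
  ultimately have "recursive_fun 2 (\<lambda>xs. xs ! 0 + xs ! 1)"
    by (rule_tac recursive_fun.cong) (auto simp: length_2_3_cases)
  from recursive_comp2[OF this assms] show ?thesis by simp
qed

lemma recursive_mult:
  assumes "recursive_fun n f" "recursive_fun n g"
  shows "recursive_fun n (\<lambda>xs. f xs * g xs)"
proof -
  have "recursive_fun 2
      (\<lambda>xs. rec_nat 0 (\<lambda>y r. (y # r # tl xs) ! 1 + (y # r # tl xs) ! 2) (hd xs))"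
    using recursive_fun.prim_rec[of 1 "\<lambda>xs. 0" "\<lambda>xs. xs ! 1 + xs ! 2"]
    by (simp add: recursive_fun.proj recursive_fun.zero recursive_add numeral_2_eq_2)
  moreover have "rec_nat 0 (\<lambda>y r. r + b) a = a * b" for a b :: nat
    by (induction a) auto
  ultimately have "recursive_fun 2 (\<lambda>xs. xs ! 0 * xs ! 1)"
    by (rule_tac recursive_fun.cong) (auto simp: length_2_3_cases)
  from recursive_comp2[OF this assms] show ?thesis by simp
qed

text \<open>Truncated subtraction iterates the predecessor, which itself arises from a recursion
  returning its counter. The recursion runs over the subtrahend, which is why the arguments are
  swapped at the end.\<close>

lemma recursive_diff:
  assumes "recursive_fun n f" "recursive_fun n g"
  shows "recursive_fun n (\<lambda>xs. f xs - g xs)"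
proof -
  have "recursive_fun 1 (\<lambda>xs. rec_nat 0 (\<lambda>y r. (y # r # tl xs) ! 0) (hd xs))"
    using recursive_fun.prim_rec[of 0 "\<lambda>xs. 0" "\<lambda>xs. xs ! 0"]
    by (simp add: recursive_fun.proj recursive_fun.zero)
  moreover have "rec_nat 0 (\<lambda>y r. y) a = a - 1" for a :: nat
    by (cases a) auto
  ultimately have "recursive_fun 1 (\<lambda>xs. xs ! 0 - 1)"
    by (rule_tac recursive_fun.cong) (auto simp: length_Suc_conv)
  from recursive_comp1[OF this]
  have pred: "recursive_fun k (\<lambda>xs. h xs - 1)" if "recursive_fun k h" for k h
    using that by simp
  have "recursive_fun 2
      (\<lambda>xs. rec_nat (tl xs ! 0) (\<lambda>y r. (y # r # tl xs) ! 1 - 1) (hd xs))"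
    using recursive_fun.prim_rec[of 1 "\<lambda>xs. xs ! 0" "\<lambda>xs. xs ! 1 - 1"]
    by (simp add: recursive_fun.proj pred[simplified] numeral_2_eq_2)
  moreover have "rec_nat b (\<lambda>y r. r - 1) a = b - a" for a b :: nat
    by (induction a) auto
  ultimately have "recursive_fun 2 (\<lambda>xs. xs ! 1 - xs ! 0)"
    by (rule_tac recursive_fun.cong) (auto simp: length_2_3_cases)
  from recursive_comp2[OF this assms(2,1)] show ?thesis by simp
qed

text \<open>A recursion on the condition whose step ignores the recursive value is a case
  distinction.\<close>

lemma recursive_if_zero:
  assumes "recursive_fun n c" "recursive_fun n f" "recursive_fun n g"
  shows "recursive_fun n (\<lambda>xs. if c xs = 0 then f xs else g xs)"
proof -
  have "recursive_fun 3
      (\<lambda>xs. rec_nat (tl xs ! 0) (\<lambda>y r. (y # r # tl xs) ! 3) (hd xs))"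
    using recursive_fun.prim_rec[of 2 "\<lambda>xs. xs ! 0" "\<lambda>xs. xs ! 3"]
    by (simp add: recursive_fun.proj numeral_3_eq_3)
  moreover have "rec_nat a (\<lambda>y r. b) c = (if c = 0 then a else b)" for a b c :: nat
    by (cases c) auto
  ultimately have "recursive_fun 3 (\<lambda>xs. if xs ! 0 = 0 then xs ! 1 else xs ! 2)"
    by (rule_tac recursive_fun.cong) (auto simp: length_2_3_cases)
  from recursive_comp3[OF this assms] show ?thesis by (simp add: numeral_2_eq_2 cong: if_cong)
qed

lemma recursive_triangle:
  assumes "recursive_fun n f"
  shows "recursive_fun n (\<lambda>xs. triangle (f xs))"
proof -
  have "recursive_fun 1
      (\<lambda>xs. rec_nat 0 (\<lambda>y r. (y # r # tl xs) ! 1 + Suc ((y # r # tl xs) ! 0)) (hd xs))"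
    using recursive_fun.prim_rec[of 0 "\<lambda>xs. 0" "\<lambda>xs. xs ! 1 + Suc (xs ! 0)"]
    by (simp add: recursive_fun.proj recursive_fun.zero recursive_add recursive_Suc
        del: add_Suc_right)
  moreover have "rec_nat 0 (\<lambda>y r. r + Suc y) a = triangle a" for a :: nat
    by (induction a) auto
  ultimately have "recursive_fun 1 (\<lambda>xs. triangle (xs ! 0))"
    by (rule_tac recursive_fun.cong) (auto simp: length_Suc_conv)
  from recursive_comp1[OF this assms] show ?thesis by simp
qed

lemma recursive_prod_encode:
  assumes "recursive_fun n f" "recursive_fun n g"
  shows "recursive_fun n (\<lambda>xs. prod_encode (f xs, g xs))"
  unfolding prod_encode_def using assms by (simp add: recursive_add recursive_triangle)

lemma recursive_list_encode_Cons:
  assumes "recursive_fun n f" "recursive_fun n (\<lambda>xs. list_encode (g xs))"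
  shows "recursive_fun n (\<lambda>xs. list_encode (f xs # g xs))"
  using assms by (simp add: recursive_Suc recursive_prod_encode)

section \<open>Inverting the pairing function\<close>

lemma triangle_mono: "m \<le> n \<Longrightarrow> triangle m \<le> triangle n"
  by (induction n) (auto simp: le_Suc_eq)

lemma le_triangle: "n \<le> triangle n"
  by (induction n) auto

text \<open>The code of \<open>(a, b)\<close> is \<open>triangle (a + b) + a\<close>, which lies in
  the half-open interval from \<open>triangle (a + b)\<close> to
  \<open>triangle (Suc (a + b))\<close>. With truncated subtraction the condition says that the code
  is below \<open>triangle (Suc r)\<close>, so the least such \<open>r\<close> is the index of the
  diagonal.\<close>

lemma Least_triangle_prod_encode:
  "(LEAST r. Suc (prod_encode (a, b)) - triangle (Suc r) = 0) = a + b"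
proof (rule Least_equality)
  show "Suc (prod_encode (a, b)) - triangle (Suc (a + b)) = 0"
    by (simp add: prod_encode_def)
  fix r assume r: "Suc (prod_encode (a, b)) - triangle (Suc r) = 0"
  show "a + b \<le> r"
  proof (rule ccontr)
    assume "\<not> a + b \<le> r"
    then have "triangle (Suc r) \<le> triangle (a + b)" by (intro triangle_mono) simp
    with r show False by (simp add: prod_encode_def)
  qed
qed

text \<open>Minimisation finds the diagonal \<open>root n\<close> of the code \<open>n\<close>, and
  both components are differences formed from \<open>n\<close> and \<open>root n\<close>. The search
  is regular because \<open>Suc n \<le> triangle (Suc n)\<close>, so that \<open>n\<close> itself is
  a candidate.\<close>

lemma recursive_prod_decode:
  shows "recursive_fun 1 (\<lambda>xs. fst (prod_decode (xs ! 0)))"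
    and "recursive_fun 1 (\<lambda>xs. snd (prod_decode (xs ! 0)))"
proof -
  define root where "root n = (LEAST r. Suc n - triangle (Suc r) = 0)" for n
  have "recursive_fun 1 (\<lambda>xs. LEAST y. Suc ((y # xs) ! 1) - triangle (Suc ((y # xs) ! 0)) = 0)"
  proof (rule recursive_fun.minim)
    show "recursive_fun (Suc 1) (\<lambda>xs. Suc (xs ! 1) - triangle (Suc (xs ! 0)))"
      by (intro recursive_diff recursive_triangle recursive_Suc recursive_fun.proj) auto
    show "\<forall>xs. length xs = 1 \<longrightarrow>
        (\<exists>y. Suc ((y # xs) ! 1) - triangle (Suc ((y # xs) ! 0)) = 0)"
    proof (intro allI impI)
      fix xs :: "nat list"
      show "\<exists>y. Suc ((y # xs) ! 1) - triangle (Suc ((y # xs) ! 0)) = 0"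
        using le_triangle[of "Suc (xs ! 0)"] by (intro exI[of _ "xs ! 0"]) simp
    qed
  qed
  then have root: "recursive_fun 1 (\<lambda>xs. root (xs ! 0))"
    unfolding root_def by simp
  have decode: "fst (prod_decode n) = n - triangle (root n)"
    "snd (prod_decode n) = root n - (n - triangle (root n))" for n
  proof -
    obtain a b where ab: "prod_decode n = (a, b)" by fastforce
    then have n: "n = prod_encode (a, b)" by (metis prod_decode_inverse)
    have "root n = a + b" unfolding root_def n by (rule Least_triangle_prod_encode)
    moreover from n have "n = triangle (a + b) + a" by (simp add: prod_encode_def)
    ultimately show "fst (prod_decode n) = n - triangle (root n)"
      "snd (prod_decode n) = root n - (n - triangle (root n))"
      using ab by auto
  qed
  show "recursive_fun 1 (\<lambda>xs. fst (prod_decode (xs ! 0)))"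
    and "recursive_fun 1 (\<lambda>xs. snd (prod_decode (xs ! 0)))"
    unfolding decode
    by (intro recursive_diff recursive_triangle root recursive_fun.proj; simp)+
qed


section \<open>The effective subshift\<close>

text \<open>
  The second branch forbids the symbol 5. It is taken when the four positions are not distinct,
  since \<^const>\<open>coded_pattern\<close> would then silently drop a cell.
\<close>

definition conflict_code :: "nat \<Rightarrow> nat \<Rightarrow> nat \<Rightarrow> nat \<Rightarrow> nat" where
  "conflict_code a b c d = (if distinct [a, b, c, d]
    then list_encode [prod_encode (a, 3), prod_encode (b, 4), prod_encode (c, 1), prod_encode (d, 2)]
    else list_encode [prod_encode (a, 5)])"

lemma recursive_conflict_code:
  assumes "recursive_fun n a" "recursive_fun n b" "recursive_fun n c" "recursive_fun n d"
  shows "recursive_fun n (\<lambda>xs. conflict_code (a xs) (b xs) (c xs) (d xs))"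
proof -
  have neq: "recursive_fun n (\<lambda>xs. (f xs - g xs) + (g xs - f xs))"
    if "recursive_fun n f" "recursive_fun n g" for f g
    using that by (intro recursive_add recursive_diff)
  \<comment> \<open>\<open>\<delta>\<close> is the absolute difference, so the product over the six
    pairs vanishes exactly when two of the four positions coincide.\<close>
  define \<delta> :: "nat \<Rightarrow> nat \<Rightarrow> nat" where "\<delta> x y = (x - y) + (y - x)" for x y
  have "conflict_code a b c d =
    (if \<delta> a b * \<delta> a c * \<delta> a d * \<delta> b c * \<delta> b d * \<delta> c d = 0 then list_encode [prod_encode (a, 5)]
    else list_encode [prod_encode (a, 3), prod_encode (b, 4), prod_encode (c, 1), prod_encode (d, 2)])"
    for a b c d
    unfolding conflict_code_def by (auto simp: \<delta>_def)
  then show ?thesis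
    unfolding \<delta>_def
    by (simp only:, intro recursive_if_zero recursive_mult neq recursive_list_encode_Cons
      recursive_prod_encode recursive_const assms)
qed

text \<open>The base point ranges over the whole group but the displacements only over
  \<open>H\<close>, so all four positions lie in the coset \<open>H a\<close>. One predicate thus
  serves both for the \<open>H\<close>-subshift (with \<open>H\<close> as the group) and for the
  induced \<open>G\<close>-subshift.\<close>

definition conflict_free :: "('g, 'm) monoid_scheme \<Rightarrow> 'g set \<Rightarrow> ('g \<Rightarrow> nat) \<Rightarrow> bool" where
  "conflict_free G H x \<longleftrightarrow> (\<forall>a\<in>carrier G. \<forall>k\<in>H. \<forall>h\<in>H.
    \<not> (x a = 3 \<and> x (k \<otimes>\<^bsub>G\<^esub> a) = 4 \<and> x (h \<otimes>\<^bsub>G\<^esub> a) = 1 \<and> x (h \<otimes>\<^bsub>G\<^esub> k \<otimes>\<^bsub>G\<^esub> a) = 2))"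

lemma conflict_freeD:
  assumes "conflict_free G H x" "a \<in> carrier G" "k \<in> H" "h \<in> H"
  shows "\<not> (x a = 3 \<and> x (k \<otimes>\<^bsub>G\<^esub> a) = 4 \<and> x (h \<otimes>\<^bsub>G\<^esub> a) = 1 \<and> x (h \<otimes>\<^bsub>G\<^esub> k \<otimes>\<^bsub>G\<^esub> a) = 2)"
  using assms unfolding conflict_free_def by blast

lemma coded_pattern_list_encode:
  "coded_pattern G \<nu> (list_encode (map prod_encode ps)) = (map_of ps \<circ> \<nu>) |` carrier G"
  by (simp add: coded_pattern_def comp_def)

text \<open>The forbidden patterns are indexed by pairs \<open>(k, h)\<close>, with the marker 3
  placed at the identity; shift invariance provides all other base points. The alphabet contains 5
  so that the degenerate codes also denote patterns over it.\<close>

lemma exists_effective_conflict_subshift: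
  assumes "group H" "infinite (carrier H)" "computable_copy H \<nu>"
  obtains X where "effective_subshift H \<nu> {..5} X"
    and "\<And>x. x \<in> configs H {..4} \<Longrightarrow> conflict_free H (carrier H) x \<Longrightarrow> x \<in> X"
    and "\<And>x. x \<in> X \<Longrightarrow> conflict_free H (carrier H) x"
proof -
  interpret group H by fact
  \<comment> \<open>An infinite group is numbered by all of the naturals, so every number may be
    decoded as a group element in the enumeration below.\<close>
  from assms(2,3) obtain m where bij: "bij_betw \<nu> (carrier H) UNIV"
    and m: "recursive_fun 2 m"
      "\<And>g h. g \<in> carrier H \<Longrightarrow> h \<in> carrier H \<Longrightarrow> m [\<nu> g, \<nu> h] = \<nu> (g \<otimes>\<^bsub>H\<^esub> h)"
    unfolding computable_copy_def by (metis bij_betw_finite finite_lessThan)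
  have inj: "\<nu> g = \<nu> h \<longleftrightarrow> g = h" if "g \<in> carrier H" "h \<in> carrier H" for g h
    using bij that by (meson bij_betw_imp_inj_on inj_onD)
  define code where "code k h = conflict_code (\<nu> \<one>\<^bsub>H\<^esub>) (\<nu> k) (\<nu> h) (\<nu> (h \<otimes>\<^bsub>H\<^esub> k))" for k h
  define W where "W = {code k h | k h. k \<in> carrier H \<and> h \<in> carrier H}"
  define X where "X = configs H {..5} \<inter> (\<Inter>c\<in>W. avoiding H {..5} (coded_pattern H \<nu> c))"

  \<comment> \<open>The input codes the pair \<open>(\<nu> k, \<nu> h)\<close>. The number of
    \<open>h \<otimes> k\<close> is computed by \<open>m\<close>, and the number of the identity is
    a constant.\<close>
  define f where "f = (\<lambda>xs :: nat list. conflict_code (\<nu> \<one>\<^bsub>H\<^esub>) (fst (prod_decode (xs ! 0)))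
    (snd (prod_decode (xs ! 0))) (m [snd (prod_decode (xs ! 0)), fst (prod_decode (xs ! 0))]))"
  have "recursive_fun 1 f"
    unfolding f_def
    by (intro recursive_conflict_code recursive_const recursive_prod_decode recursive_comp2[OF m(1)])
  moreover have "W = range (\<lambda>n. f [n])"
  proof (intro equalityI subsetI)
    fix c assume "c \<in> W"
    then obtain k h where kh: "k \<in> carrier H" "h \<in> carrier H" "c = code k h"
      unfolding W_def by blast
    then have "c = f [prod_encode (\<nu> k, \<nu> h)]"
      by (simp add: f_def code_def m(2))
    then show "c \<in> range (\<lambda>n. f [n])" by blast
  next
    fix c assume "c \<in> range (\<lambda>n. f [n])"
    then obtain n where n: "c = f [n]" by blast
    have surj: "\<exists>g\<in>carrier H. i = \<nu> g" for i
      using bij_betw_imp_surj_on[OF bij] by blast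
    obtain k h where kh: "k \<in> carrier H" "h \<in> carrier H"
      and "fst (prod_decode n) = \<nu> k" "snd (prod_decode n) = \<nu> h"
      using surj by meson
    with n have "c = code k h" by (simp add: f_def code_def m(2))
    with kh show "c \<in> W" unfolding W_def by blast
  qed
  ultimately have re: "recursively_enumerable W"
    unfolding recursively_enumerable_def by blast

  \<comment> \<open>In \<open>map_of\<close> the first entry for a key wins, in a chain of updates
    the last one. Both give the same pattern here because the four positions are distinct.\<close>
  have coded: "coded_pattern H \<nu> (code k h) =
      (if distinct [\<one>\<^bsub>H\<^esub>, k, h, h \<otimes>\<^bsub>H\<^esub> k]
       then [\<one>\<^bsub>H\<^esub> \<mapsto> 3, k \<mapsto> 4, h \<mapsto> 1, h \<otimes>\<^bsub>H\<^esub> k \<mapsto> 2] else [\<one>\<^bsub>H\<^esub> \<mapsto> 5])"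
    if kh: "k \<in> carrier H" "h \<in> carrier H" for k h
  proof -
    have d: "distinct [\<nu> \<one>\<^bsub>H\<^esub>, \<nu> k, \<nu> h, \<nu> (h \<otimes>\<^bsub>H\<^esub> k)] \<longleftrightarrow> distinct [\<one>\<^bsub>H\<^esub>, k, h, h \<otimes>\<^bsub>H\<^esub> k]"
      using kh by (simp add: inj)
    show ?thesis
    proof (cases "distinct [\<one>\<^bsub>H\<^esub>, k, h, h \<otimes>\<^bsub>H\<^esub> k]")
      case True
      have "code k h = list_encode (map prod_encode
          [(\<nu> \<one>\<^bsub>H\<^esub>, 3), (\<nu> k, 4), (\<nu> h, 1), (\<nu> (h \<otimes>\<^bsub>H\<^esub> k), 2)])"
        unfolding code_def conflict_code_def d using True by simp
      then have "coded_pattern H \<nu> (code k h) =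
          (map_of [(\<nu> \<one>\<^bsub>H\<^esub>, 3), (\<nu> k, 4), (\<nu> h, 1), (\<nu> (h \<otimes>\<^bsub>H\<^esub> k), 2)] \<circ> \<nu>) |` carrier H"
        by (simp only: coded_pattern_list_encode)
      then have "coded_pattern H \<nu> (code k h) l = [\<one>\<^bsub>H\<^esub> \<mapsto> 3, k \<mapsto> 4, h \<mapsto> 1, h \<otimes>\<^bsub>H\<^esub> k \<mapsto> 2] l" for l
        using True kh by (cases "l \<in> carrier H") (auto simp: restrict_map_def inj)
      then show ?thesis
        unfolding if_P[OF True] by (rule ext)
    next
      case False
      have "code k h = list_encode (map prod_encode [(\<nu> \<one>\<^bsub>H\<^esub>, 5)])"
        unfolding code_def conflict_code_def d using False by simp
      then have "coded_pattern H \<nu> (code k h) = (map_of [(\<nu> \<one>\<^bsub>H\<^esub>, 5)] \<circ> \<nu>) |` carrier H"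
        by (simp only: coded_pattern_list_encode)
      then have "coded_pattern H \<nu> (code k h) l = [\<one>\<^bsub>H\<^esub> \<mapsto> 5] l" for l
        using False kh by (cases "l \<in> carrier H") (auto simp: restrict_map_def inj)
      then show ?thesis
        unfolding if_not_P[OF False] by (rule ext)
    qed
  qed
  have pat: "pattern H {..5} (coded_pattern H \<nu> (code k h))"
    if "k \<in> carrier H" "h \<in> carrier H" for k h
  proof -
    have upd: "ran (p(l \<mapsto> v)) \<subseteq> insert v (ran p)" for p :: "'a \<rightharpoonup> nat" and l v
      by (auto simp: ran_def)
    have "ran (coded_pattern H \<nu> (code k h)) \<subseteq> {1, 2, 3, 4, 5}"
    proof (cases "distinct [\<one>\<^bsub>H\<^esub>, k, h, h \<otimes>\<^bsub>H\<^esub> k]")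
      case True
      have "ran [\<one>\<^bsub>H\<^esub> \<mapsto> 3, k \<mapsto> 4, h \<mapsto> 1, h \<otimes>\<^bsub>H\<^esub> k \<mapsto> 2]
          \<subseteq> insert 2 (insert 1 (insert 4 (insert (3 :: nat) {})))"
        by (intro order_trans[OF upd] insert_mono) simp
      then show ?thesis
        unfolding coded[OF that] if_P[OF True] by blast
    next
      case False
      then show ?thesis
        unfolding coded[OF that] if_not_P[OF False] by simp
    qed
    moreover have "finite (dom (coded_pattern H \<nu> (code k h)))"
      "dom (coded_pattern H \<nu> (code k h)) \<subseteq> carrier H"
      using that unfolding coded[OF that] by (simp_all split: if_split)
    moreover have "{1, 2, 3, 4, 5} \<subseteq> {..5 :: nat}" by simp
    ultimately show ?thesis
      unfolding pattern_def by (meson order_trans)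
  qed
  have occurrence: "(\<exists>l\<in>dom (coded_pattern H \<nu> (code k h)).
        Some (x (l \<otimes>\<^bsub>H\<^esub> g)) \<noteq> coded_pattern H \<nu> (code k h) l) \<longleftrightarrow>
      (if distinct [\<one>\<^bsub>H\<^esub>, k, h, h \<otimes>\<^bsub>H\<^esub> k]
       then \<not> (x g = 3 \<and> x (k \<otimes>\<^bsub>H\<^esub> g) = 4 \<and> x (h \<otimes>\<^bsub>H\<^esub> g) = 1 \<and> x (h \<otimes>\<^bsub>H\<^esub> k \<otimes>\<^bsub>H\<^esub> g) = 2)
       else x g \<noteq> 5)"
    if khg: "k \<in> carrier H" "h \<in> carrier H" "g \<in> carrier H" for k h g and x :: "'a \<Rightarrow> nat"
  proof (cases "distinct [\<one>\<^bsub>H\<^esub>, k, h, h \<otimes>\<^bsub>H\<^esub> k]")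
    case True
    define p :: "'a \<rightharpoonup> nat" where "p = [\<one>\<^bsub>H\<^esub> \<mapsto> 3, k \<mapsto> 4, h \<mapsto> 1, h \<otimes>\<^bsub>H\<^esub> k \<mapsto> 2]"
    have "dom p = {\<one>\<^bsub>H\<^esub>, k, h, h \<otimes>\<^bsub>H\<^esub> k}" by (auto simp: p_def)
    moreover have "p \<one>\<^bsub>H\<^esub> = Some 3" "p k = Some 4" "p h = Some 1" "p (h \<otimes>\<^bsub>H\<^esub> k) = Some 2"
      using True by (auto simp: p_def)
    ultimately show ?thesis
      unfolding coded[OF khg(1,2)] if_P[OF True] p_def[symmetric] using khg by simp
  next
    case False
    then show ?thesis
      unfolding coded[OF khg(1,2)] if_not_P[OF False] using khg by simp
  qed
  have "X = {x \<in> configs H {..5}. \<forall>k\<in>carrier H. \<forall>h\<in>carrier H.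
      x \<in> avoiding H {..5} (coded_pattern H \<nu> (code k h))}"
    unfolding X_def W_def by blast
  also have "\<dots> = {x \<in> configs H {..5}. \<forall>k\<in>carrier H. \<forall>h\<in>carrier H. \<forall>g\<in>carrier H.
      if distinct [\<one>\<^bsub>H\<^esub>, k, h, h \<otimes>\<^bsub>H\<^esub> k]
      then \<not> (x g = 3 \<and> x (k \<otimes>\<^bsub>H\<^esub> g) = 4 \<and> x (h \<otimes>\<^bsub>H\<^esub> g) = 1 \<and> x (h \<otimes>\<^bsub>H\<^esub> k \<otimes>\<^bsub>H\<^esub> g) = 2)
      else x g \<noteq> 5}"
    by (intro Collect_cong conj_cong refl ball_cong)
      (simp only: avoiding_alt[OF pat] mem_Collect_eq occurrence simp_thms cong: ball_cong)
  finally have X_eq: "X = \<dots>" .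
  show thesis
  proof
    have "pattern H {..5} (coded_pattern H \<nu> c)" if "c \<in> W" for c
      using that pat unfolding W_def by blast
    then show "effective_subshift H \<nu> {..5} X"
      unfolding effective_subshift_def
      using subshift_avoiding[OF assms(1), of "{..5}" "coded_pattern H \<nu> ` W"] re
      by (auto simp: X_def)
  next
    fix x assume x: "x \<in> configs H {..4}" "conflict_free H (carrier H) x"
    have "x \<in> configs H {..5}"
      using x(1) PiE_mono[of "carrier H" "\<lambda>_. {..4 :: nat}" "\<lambda>_. {..5}"]
      unfolding configs_def by auto
    moreover have "x g \<noteq> 5" if "g \<in> carrier H" for g
      using PiE_mem[OF x(1)[unfolded configs_def] that] by auto
    ultimately show "x \<in> X"
      using x(2) unfolding X_eq conflict_free_def by (simp only: mem_Collect_eq if_bool_eq_conj) blast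
  next
    fix x assume x: "x \<in> X"
    show "conflict_free H (carrier H) x"
      unfolding conflict_free_def
    proof (intro ballI notI)
      fix a k h assume akh: "a \<in> carrier H" "k \<in> carrier H" "h \<in> carrier H"
        and v: "x a = 3 \<and> x (k \<otimes>\<^bsub>H\<^esub> a) = 4 \<and> x (h \<otimes>\<^bsub>H\<^esub> a) = 1 \<and> x (h \<otimes>\<^bsub>H\<^esub> k \<otimes>\<^bsub>H\<^esub> a) = 2"
      \<comment> \<open>The symbols 3, 4, 1, 2 differ pairwise, so a conflict can only occur at four
        distinct positions. Hence nothing is lost by replacing the patterns of degenerate
        pairs.\<close>
      then have "distinct (map (\<lambda>l. x (l \<otimes>\<^bsub>H\<^esub> a)) [\<one>\<^bsub>H\<^esub>, k, h, h \<otimes>\<^bsub>H\<^esub> k])"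
        by simp
      then have "distinct [\<one>\<^bsub>H\<^esub>, k, h, h \<otimes>\<^bsub>H\<^esub> k]"
        unfolding distinct_map by blast
      with x akh v show False
        unfolding X_eq by (simp only: mem_Collect_eq if_bool_eq_conj)
    qed
  qed
qed

section \<open>Passage to the induced subshift\<close>

text \<open>A conflict of \<open>y\<close> based at \<open>a\<close> stays inside the coset
  \<open>H a\<close>. It is therefore a conflict, based at the identity, of the configuration that
  \<open>y\<close> induces on \<open>H\<close> through \<open>a\<close>; conversely, conflicts of
  the induced configurations are conflicts of \<open>y\<close>.\<close>

lemma induced_subshift_conflict_free:
  assumes "group G" "subgroup H G"
    and X1: "\<And>x. x \<in> configs (G\<lparr>carrier := H\<rparr>) {..4} \<Longrightarrow> conflict_free (G\<lparr>carrier := H\<rparr>) H x \<Longrightarrow> x \<in> X"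
    and X2: "\<And>x. x \<in> X \<Longrightarrow> conflict_free (G\<lparr>carrier := H\<rparr>) H x"
  shows "y \<in> configs G {..4} \<Longrightarrow> conflict_free G H y \<Longrightarrow> y \<in> induced_subshift G H {..5} X"
    and "y \<in> induced_subshift G H {..5} X \<Longrightarrow> conflict_free G H y"
proof -
  interpret group G by fact
  interpret subgroup H G by fact
  assume y: "y \<in> configs G {..4}" "conflict_free G H y"
  have "(\<lambda>h\<in>H. y (h \<otimes>\<^bsub>G\<^esub> g)) \<in> X" if g: "g \<in> carrier G" for g
  proof (rule X1)
    show "(\<lambda>h\<in>H. y (h \<otimes>\<^bsub>G\<^esub> g)) \<in> configs (G\<lparr>carrier := H\<rparr>) {..4}"
      using y(1) g by (auto simp: configs_def PiE_def Pi_def)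
    show "conflict_free (G\<lparr>carrier := H\<rparr>) H (\<lambda>h\<in>H. y (h \<otimes>\<^bsub>G\<^esub> g))"
      using y(2) g unfolding conflict_free_def by (simp add: m_assoc)
  qed
  moreover have "y \<in> configs G {..5}"
    using y(1) by (auto simp: configs_def PiE_def Pi_def le_Suc_eq)
  ultimately show "y \<in> induced_subshift G H {..5} X"
    unfolding induced_subshift_def by blast
next
  interpret group G by fact
  interpret subgroup H G by fact
  assume y: "y \<in> induced_subshift G H {..5} X"
  show "conflict_free G H y"
    unfolding conflict_free_def
  proof (intro ballI)
    fix a k h assume akh: "a \<in> carrier G" "k \<in> H" "h \<in> H"
    then have "conflict_free (G\<lparr>carrier := H\<rparr>) H (\<lambda>h\<in>H. y (h \<otimes>\<^bsub>G\<^esub> a))"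
      using y X2 unfolding induced_subshift_def by blast
    then show "\<not> (y a = 3 \<and> y (k \<otimes>\<^bsub>G\<^esub> a) = 4 \<and> y (h \<otimes>\<^bsub>G\<^esub> a) = 1 \<and> y (h \<otimes>\<^bsub>G\<^esub> k \<otimes>\<^bsub>G\<^esub> a) = 2)"
      using akh conflict_freeD[of "G\<lparr>carrier := H\<rparr>" H _ "\<one>\<^bsub>G\<^esub>" k h] by fastforce
  qed
qed


section \<open>Configurations separating the patterns of a finite set\<close>

lemma (in group) inv_cancel:
  assumes "x \<in> carrier G" "y \<in> carrier G"
  shows "inv x \<otimes> (x \<otimes> y) = y" "x \<otimes> (inv x \<otimes> y) = y"
  using assms by (simp_all flip: m_assoc)

lemma (in group) finite_quotients:
  assumes "finite F" "finite E"
  shows "finite {d. \<exists>f\<in>F. \<exists>e\<in>E. d = f \<otimes> inv e}"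
proof -
  have "{d. \<exists>f\<in>F. \<exists>e\<in>E. d = f \<otimes> inv e} = (\<lambda>(f, e). f \<otimes> inv e) ` (F \<times> E)" by auto
  then show ?thesis using assms by simp
qed

text \<open>The predicate from which \<open>r f\<close> is chosen depends only on the coset
  \<open>H f\<close>, so \<open>SOME\<close> returns the same element throughout a coset. Keeping
  the representatives in \<open>F\<close> makes \<open>f \<otimes> inv (r f)\<close> range over a
  finite set.\<close>

lemma (in group) exists_coset_reps:
  assumes "subgroup H G" "F \<subseteq> carrier G"
  obtains r where "\<And>f. f \<in> F \<Longrightarrow> r f \<in> F" "\<And>f. f \<in> F \<Longrightarrow> f \<otimes> inv (r f) \<in> H"
    "\<And>e f. e \<in> F \<Longrightarrow> f \<in> F \<Longrightarrow> e \<otimes> inv f \<in> H \<Longrightarrow> r e = r f"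
proof -
  interpret H: subgroup H G by fact
  define r where "r f = (SOME e. e \<in> F \<and> f \<otimes> inv e \<in> H)" for f
  have r: "r f \<in> F \<and> f \<otimes> inv (r f) \<in> H" if "f \<in> F" for f
  proof -
    have "f \<in> carrier G" using that assms(2) by blast
    with that have "f \<in> F \<and> f \<otimes> inv f \<in> H" by simp
    then show ?thesis unfolding r_def by (rule someI)
  qed
  moreover have "r e = r f" if ef: "e \<in> F" "f \<in> F" "e \<otimes> inv f \<in> H" for e f
  proof -
    have c: "e \<in> carrier G" "f \<in> carrier G" using ef assms by auto
    have "e \<otimes> inv d \<in> H \<longleftrightarrow> f \<otimes> inv d \<in> H" if "d \<in> F" for d
    proof -
      have d: "d \<in> carrier G" using that assms by auto
      have 1: "e \<otimes> inv d = (e \<otimes> inv f) \<otimes> (f \<otimes> inv d)"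
        using c d by (simp add: m_assoc inv_cancel)
      have 2: "f \<otimes> inv d = inv (e \<otimes> inv f) \<otimes> (e \<otimes> inv d)"
        using c d by (simp add: m_assoc inv_mult_group inv_cancel)
      show ?thesis using 1 2 ef(3) H.m_closed H.m_inv_closed by metis
    qed
    then have "(\<lambda>d. d \<in> F \<and> e \<otimes> inv d \<in> H) = (\<lambda>d. d \<in> F \<and> f \<otimes> inv d \<in> H)" by blast
    then show "r e = r f" by (simp add: r_def)
  qed
  ultimately show thesis using that by blast
qed

text \<open>
  In each coset of \<open>H\<close> that meets \<open>F\<close>, with representative \<open>e \<in> F\<close>, the marker 3 is put at \<open>s e\<close> and
  the marker 4 at \<open>t e\<close>, both outside \<open>F\<close>. Right multiplication by the displacement
  \<open>e\<inverse> s\<inverse> t e\<close> carries \<open>F\<close> (within that coset) off \<open>F\<close>, and there the complement of \<open>P\<close> is recorded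
  by the symbol 2.
\<close>

lemma (in group) exists_separating_configs:
  assumes H: "subgroup H G" "infinite H" and F: "finite F" "F \<subseteq> carrier G"
  obtains y :: "'a set \<Rightarrow> 'a \<Rightarrow> nat"
  where "\<And>P. P \<subseteq> F \<Longrightarrow> y P \<in> configs G {..4}"
    and "\<And>P. P \<subseteq> F \<Longrightarrow> conflict_free G H (y P)"
    and "\<And>P Q. P \<subseteq> F \<Longrightarrow> Q \<subseteq> F \<Longrightarrow>
      conflict_free G H (\<lambda>g. if g \<in> F then y P g else y Q g) \<Longrightarrow> P \<subseteq> Q"
proof -
  interpret H: subgroup H G by fact
  have Fc: "\<And>f. f \<in> F \<Longrightarrow> f \<in> carrier G" using F by auto
  obtain r where r: "\<And>f. f \<in> F \<Longrightarrow> r f \<in> F" "\<And>f. f \<in> F \<Longrightarrow> f \<otimes> inv (r f) \<in> H"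
    "\<And>e f. e \<in> F \<Longrightarrow> f \<in> F \<Longrightarrow> e \<otimes> inv f \<in> H \<Longrightarrow> r e = r f"
    using exists_coset_reps[OF H(1) F(2)] by blast
  have rc: "\<And>f. f \<in> F \<Longrightarrow> r f \<in> carrier G" using r(1) Fc by blast
  have rr: "r (r f) = r f" if "f \<in> F" for f
    using r(3)[OF that r(1)[OF that] r(2)[OF that]] by simp
  have reps: "r e = r f"
    if ef: "e \<in> F" "f \<in> F" and hk: "h \<in> H" "k \<in> H" "h \<otimes> r e = k \<otimes> r f" for e f h k
  proof -
    have "r e = inv h \<otimes> (k \<otimes> r f)"
      using ef hk rc[OF ef(1)] rc[OF ef(2)] by (simp add: inv_solve_left)
    then have "r e = (inv h \<otimes> k) \<otimes> r f" using ef hk rc by (simp add: m_assoc)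
    then have "r e \<otimes> inv (r f) = inv h \<otimes> k" using ef hk rc by (simp add: inv_solve_right')
    then have "r e \<otimes> inv (r f) \<in> H" using hk by simp
    from r(3)[OF r(1) r(1) this] ef show ?thesis by (simp add: rr)
  qed
  \<comment> \<open>\<open>D\<close> consists of the elements whose left translation takes some
    point of \<open>F\<close> into \<open>F\<close>. A translation by an element outside
    \<open>D\<close> moves every point of \<open>F\<close> off \<open>F\<close>.\<close>
  define D where "D = {d. \<exists>f\<in>F. \<exists>e\<in>F. d = f \<otimes> inv e}"
  have D: "finite D" unfolding D_def using F by (intro finite_quotients)
  have DI: "d \<in> D" if "d \<in> carrier G" "e \<in> F" "d \<otimes> e \<in> F" for d e
  proof -
    have "d = d \<otimes> e \<otimes> inv e" using that Fc by (simp add: m_assoc)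
    then show ?thesis using that unfolding D_def by blast
  qed
  obtain s where s: "s \<in> H" "s \<notin> D" using H(2) D by (meson finite_subset subsetI)
  \<comment> \<open>Avoiding \<open>D\<close> and \<open>s\<close> puts the marker 4 outside
    \<open>F\<close> and apart from every marker 3. The remaining elements are the solutions
    \<open>t\<close> of \<open>u \<otimes> inv s \<otimes> t = d\<close> with \<open>u\<close> in
    \<open>D\<close> and \<open>d\<close> in \<open>D\<close> or equal to \<open>s\<close>;
    excluding them keeps the symbols 2 off \<open>F\<close> and off the markers 3. Coincidence with
    a marker 4 would force \<open>u = s\<close>, which \<open>s \<notin> D\<close> excludes.\<close>
  define T where "T = D \<union> {s} \<union> (\<lambda>(u, d). s \<otimes> inv u \<otimes> d) ` (D \<times> (D \<union> {s}))"
  have "finite T" unfolding T_def using D by simp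
  then obtain t where t: "t \<in> H" "t \<notin> T" using H(2) by (meson finite_subset subsetI)
  have st: "s \<in> carrier G" "t \<in> carrier G" using s t by auto
  have off: "u \<otimes> inv s \<otimes> t \<notin> D \<union> {s, t}" if u: "u \<in> D" for u
  proof
    assume a: "u \<otimes> inv s \<otimes> t \<in> D \<union> {s, t}"
    have uc: "u \<in> carrier G" using u Fc unfolding D_def by auto
    have "u \<otimes> inv s \<otimes> t = t \<Longrightarrow> u = s"
      using uc st by (metis inv_closed inv_equality inv_inv m_closed r_cancel_one')
    then have "u \<otimes> inv s \<otimes> t \<in> D \<union> {s}" using a u s by auto
    moreover have "t = s \<otimes> inv u \<otimes> (u \<otimes> inv s \<otimes> t)"
      using uc st by (simp add: m_assoc inv_cancel)
    ultimately have "t \<in> T" using u unfolding T_def by force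
    then show False using t by blast
  qed
  \<comment> \<open>Left multiplication by \<open>h = f \<otimes> inv (r f) \<otimes> inv s\<close>
    takes the marker position \<open>s \<otimes> r f\<close> to \<open>f\<close> and
    \<open>t \<otimes> r f\<close> to \<open>c f\<close>. So \<open>c f\<close> is the place around
    the marker 4 that corresponds to \<open>f\<close>.\<close>
  define c where "c f = f \<otimes> inv (r f) \<otimes> inv s \<otimes> t \<otimes> r f" for f
  have c_eq: "c f = (f \<otimes> inv (r f) \<otimes> inv s \<otimes> t) \<otimes> r f" for f by (simp add: c_def)
  have cc: "c f \<in> carrier G" if "f \<in> F" for f
    unfolding c_def using that Fc rc st by simp
  have uD: "f \<otimes> inv (r f) \<in> D" if "f \<in> F" for f using that r(1) unfolding D_def by blast
  have s_off: "s \<otimes> r e \<notin> F" and t_off: "t \<otimes> r e \<notin> F" if "e \<in> F" for e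
    using DI[of s "r e"] DI[of t "r e"] that r(1) s t st unfolding T_def by auto
  have t_ne_s: "t \<otimes> r e \<noteq> s \<otimes> r f" if "e \<in> F" "f \<in> F" for e f
  proof
    assume a: "t \<otimes> r e = s \<otimes> r f"
    then have "r e = r f" using reps that s t by blast
    then have "t = s" using a that rc st by simp
    then show False using t unfolding T_def by blast
  qed
  have c_off: "c f \<notin> F" if "f \<in> F" for f
    using DI[of "f \<otimes> inv (r f) \<otimes> inv s \<otimes> t" "r f"] off[OF uD[OF that]] that r(1) Fc rc st
    unfolding c_eq by auto
  have c_ne: "c f \<noteq> s \<otimes> r e" "c f \<noteq> t \<otimes> r e" if "e \<in> F" "f \<in> F" for e f
  proof -
    have *: "f \<otimes> inv (r f) \<otimes> inv s \<otimes> t = x" if "c f = x \<otimes> r e" "x \<in> H" for x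
    proof -
      have "r f = r e"
        using reps[of f e "f \<otimes> inv (r f) \<otimes> inv s \<otimes> t" x] \<open>e \<in> F\<close> \<open>f \<in> F\<close> r(2) s t that
        unfolding c_eq by simp
      then show ?thesis
        using that \<open>e \<in> F\<close> \<open>f \<in> F\<close> rc Fc st unfolding c_eq by simp
    qed
    show "c f \<noteq> s \<otimes> r e" "c f \<noteq> t \<otimes> r e"
      using *[of s] *[of t] off[OF uD[OF \<open>f \<in> F\<close>]] s t by auto
  qed
  \<comment> \<open>For \<open>P \<subseteq> F\<close> the four kinds of positions are disjoint by
    the preceding facts, so the order of the tests is immaterial. All other cells get the neutral
    symbol 0.\<close>
  define y where "y P = (\<lambda>g\<in>carrier G. if g \<in> P then 1 else if \<exists>e\<in>F. g = s \<otimes> r e then 3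
    else if \<exists>e\<in>F. g = t \<otimes> r e then 4 else if \<exists>f\<in>F - P. g = c f then 2 else (0 :: nat))" for P
  have "y P \<in> configs G {..4}" for P
    unfolding y_def configs_def by auto
  moreover have "conflict_free G H (y P)" if P: "P \<subseteq> F" for P
    unfolding conflict_free_def
  proof (intro ballI notI; elim conjE)
    fix a k h assume akh: "a \<in> carrier G" "k \<in> H" "h \<in> H"
      and v: "y P a = 3" "y P (k \<otimes> a) = 4" "y P (h \<otimes> a) = 1" "y P (h \<otimes> k \<otimes> a) = 2"
    obtain e where e: "e \<in> F" "a = s \<otimes> r e"
      using v(1) akh unfolding y_def by (auto split: if_splits)
    obtain e' where e': "e' \<in> F" "k \<otimes> a = t \<otimes> r e'"
      using v(2) akh unfolding y_def by (auto split: if_splits)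
    \<comment> \<open>Both markers and the symbol 2 lie in one coset and hence share a
      representative. Cancelling it makes \<open>h \<otimes> a\<close> the very element
      \<open>f'\<close> whose absence from \<open>P\<close> the symbol 2 records.\<close>
    have "(k \<otimes> s) \<otimes> r e = t \<otimes> r e'" using e e' rc akh st by (simp add: m_assoc)
    with reps[of e e' "k \<otimes> s" t] e e' akh s t have "r e = r e'" by simp
    with e'(2) have ka: "k \<otimes> a = t \<otimes> r e" by simp
    have f: "h \<otimes> a \<in> P" using v(3) akh unfolding y_def by (auto split: if_splits)
    obtain f' where f': "f' \<in> F" "f' \<notin> P" "h \<otimes> k \<otimes> a = c f'"
      using v(4) akh unfolding y_def by (auto split: if_splits)
    have "(h \<otimes> t) \<otimes> r e = c f'" using f'(3) ka akh st e rc by (simp add: m_assoc)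
    then have *: "(h \<otimes> t) \<otimes> r e = (f' \<otimes> inv (r f') \<otimes> inv s \<otimes> t) \<otimes> r f'" by (simp add: c_eq)
    from reps[OF e(1) f'(1) _ _ this] akh s t r(2) f'(1) have re: "r e = r f'" by simp
    with * have "h = f' \<otimes> inv (r f') \<otimes> inv s"
      using akh st e f' rc Fc by simp
    then have "h \<otimes> a = f'"
      using e(2) re st f' rc Fc by (simp add: m_assoc inv_cancel)
    with f f' show False by simp
  qed
  moreover have "P \<subseteq> Q" if PQ: "P \<subseteq> F" "Q \<subseteq> F"
    and free: "conflict_free G H (\<lambda>g. if g \<in> F then y P g else y Q g)" for P Q
  proof (rule ccontr)
    assume "\<not> P \<subseteq> Q"
    then obtain f where f: "f \<in> P" "f \<notin> Q" by blast
    then have fF: "f \<in> F" using PQ by blast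
    \<comment> \<open>These are the parameters of a conflict in the glued configuration: the 1 at
      \<open>f\<close> comes from \<open>y P\<close>, while both markers and the 2 at
      \<open>c f\<close> lie outside \<open>F\<close> and come from \<open>y Q\<close>.\<close>
    define a where "a = s \<otimes> r f"
    define k where "k = t \<otimes> inv s"
    define h where "h = f \<otimes> inv (r f) \<otimes> inv s"
    have ka: "k \<otimes> a = t \<otimes> r f" and ha: "h \<otimes> a = f" and hka: "h \<otimes> k \<otimes> a = c f"
      using fF rc Fc st unfolding a_def k_def h_def c_def
      by (simp_all add: m_assoc inv_cancel)
    have "a \<in> carrier G" "k \<in> H" "h \<in> H"
      unfolding a_def k_def h_def using s t st r(2) rc fF by auto
    moreover have "y P f = 1" using f Fc[OF fF] by (simp add: y_def)
    moreover have "y Q a = 3" "y Q (k \<otimes> a) = 4" "y Q (c f) = 2"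
    proof -
      have "a \<notin> Q" "t \<otimes> r f \<notin> Q" "c f \<notin> Q"
        using PQ s_off[OF fF] t_off[OF fF] c_off[OF fF] unfolding a_def by auto
      then show "y Q a = 3" "y Q (k \<otimes> a) = 4" "y Q (c f) = 2"
        using fF f(2) t_ne_s[OF fF] c_ne[OF _ fF] cc[OF fF] rc[OF fF] st
        unfolding ka by (auto simp: y_def a_def)
    qed
    ultimately show False
      using conflict_freeD[OF free, of a k h] fF s_off[OF fF] t_off[OF fF] c_off[OF fF]
      unfolding ka ha hka by (simp add: a_def)
  qed
  ultimately show thesis using that by blast
qed


section \<open>Counting along Foelner sets\<close>

text \<open>A point \<open>c\<close> of \<open>F\<close> with
  \<open>l \<otimes> c \<notin> F\<close> is missing from the translate of \<open>F\<close> by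
  \<open>inv l\<close>. The boundary is therefore covered by the symmetric differences that the
  Foelner condition bounds for the inverses of \<open>L\<close>.\<close>

lemma (in group) exists_small_boundary:
  assumes "amenable G" "finite L" "L \<subseteq> carrier G"
  obtains F where "finite F" "F \<subseteq> carrier G"
    "n * card {c \<in> F. \<exists>l\<in>L. l \<otimes> c \<notin> F} < card F"
proof -
  \<comment> \<open>The union bound gives \<open>n\<close> times the boundary at most
    \<open>n * card L / (n * card L + 1)\<close> times \<open>card F\<close>; the added 1 makes the
    final inequality strict.\<close>
  define \<epsilon> where "\<epsilon> = 1 / real (Suc (n * card L))"
  have "finite (m_inv G ` L)" "m_inv G ` L \<subseteq> carrier G" "\<epsilon> > 0"
    using assms by (auto simp: \<epsilon>_def intro!: add_pos_nonneg)
  then obtain F where F: "finite F" "F \<noteq> {}" "F \<subseteq> carrier G"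
    "\<And>l. l \<in> L \<Longrightarrow> real (card (sym_diff (inv l <# F) F)) \<le> \<epsilon> * real (card F)"
    using assms(1) unfolding amenable_def by (metis imageI)
  have "{c \<in> F. \<exists>l\<in>L. l \<otimes> c \<notin> F} \<subseteq> (\<Union>l\<in>L. sym_diff (inv l <# F) F)"
  proof safe
    fix c l assume c: "c \<in> F" "l \<in> L" "l \<otimes> c \<notin> F"
    have "c \<notin> inv l <# F"
    proof
      assume "c \<in> inv l <# F"
      then obtain f where f: "f \<in> F" "c = inv l \<otimes> f" unfolding l_coset_def by blast
      moreover have "l \<in> carrier G" "f \<in> carrier G" using c f assms F by auto
      ultimately show False using c by (simp add: inv_cancel)
    qed
    with c show "c \<in> (\<Union>l\<in>L. sym_diff (inv l <# F) F)" by blast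
  qed
  moreover have fin: "finite (\<Union>l\<in>L. sym_diff (inv l <# F) F)"
    using assms F by (auto simp: l_coset_def)
  ultimately have "card {c \<in> F. \<exists>l\<in>L. l \<otimes> c \<notin> F} \<le> card (\<Union>l\<in>L. sym_diff (inv l <# F) F)"
    by (intro card_mono)
  also have "\<dots> \<le> (\<Sum>l\<in>L. card (sym_diff (inv l <# F) F))"
    using assms by (intro card_UN_le)
  finally have "real (card {c \<in> F. \<exists>l\<in>L. l \<otimes> c \<notin> F}) \<le> (\<Sum>l\<in>L. real (card (sym_diff (inv l <# F) F)))"
    by (simp only: of_nat_le_iff flip: of_nat_sum)
  also have "\<dots> \<le> (\<Sum>l\<in>L. \<epsilon> * real (card F))"
    using F(4) by (intro sum_mono)
  also have "\<dots> = \<epsilon> * (real (card L) * real (card F))" by simp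
  finally have "real (Suc (n * card L)) * real (card {c \<in> F. \<exists>l\<in>L. l \<otimes> c \<notin> F})
      \<le> real (Suc (n * card L)) * (\<epsilon> * (real (card L) * real (card F)))"
    by (rule mult_left_mono) simp
  also have "\<dots> = real (card L) * real (card F)"
    unfolding \<epsilon>_def by (simp del: of_nat_Suc)
  finally have "real (Suc (n * card L)) * real (card {c \<in> F. \<exists>l\<in>L. l \<otimes> c \<notin> F})
      \<le> real (card L) * real (card F)" .
  then have le: "Suc (n * card L) * card {c \<in> F. \<exists>l\<in>L. l \<otimes> c \<notin> F} \<le> card L * card F"
    by (simp only: of_nat_le_iff flip: of_nat_mult)
  have "n * card {c \<in> F. \<exists>l\<in>L. l \<otimes> c \<notin> F} < card F"
  proof (cases "card L = 0")
    case True
    then have "L = {}" using assms by simp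
    then show ?thesis using F by (simp add: card_gt_0_iff)
  next
    case False
    have pos: "card L * card F > 0" using False F by (simp add: card_gt_0_iff)
    have "card L * (n * card {c \<in> F. \<exists>l\<in>L. l \<otimes> c \<notin> F}) < card L * card F"
    proof (cases "card {c \<in> F. \<exists>l\<in>L. l \<otimes> c \<notin> F} = 0")
      case True
      show ?thesis unfolding True using pos by simp
    next
      case False
      then have "card L * (n * card {c \<in> F. \<exists>l\<in>L. l \<otimes> c \<notin> F})
          < Suc (n * card L) * card {c \<in> F. \<exists>l\<in>L. l \<otimes> c \<notin> F}"
        by (simp only: neq0_conv mult_Suc mult_ac less_add_same_cancel2)
      then show ?thesis using le by (rule less_le_trans)
    qed
    then show ?thesis by simp
  qed
  with F that show thesis by blast
qed

section \<open>Gluing in subshifts of finite type and the final count\<close>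

text \<open>\<open>L\<close> consists of the quotients of the union \<open>K\<close> of all supports
  of forbidden patterns. If a translated support leaves \<open>F\<close>, such a quotient carries
  each of its cells out of \<open>F\<close>, so its cells in \<open>F\<close> are boundary cells,
  where \<open>z\<close> and \<open>z'\<close> agree. Every translated support thus reads either
  only \<open>z\<close> or only \<open>z'\<close>.\<close>

lemma (in group) SFT_glue:
  assumes "SFT G B Z"
  obtains L where "finite L" "L \<subseteq> carrier G"
    "\<And>F z z'. z \<in> Z \<Longrightarrow> z' \<in> Z \<Longrightarrow>
      (\<And>c. c \<in> F \<Longrightarrow> c \<in> carrier G \<Longrightarrow> \<exists>l\<in>L. l \<otimes> c \<notin> F \<Longrightarrow> z c = z' c) \<Longrightarrow>
      (\<lambda>g. if g \<in> F then z g else z' g) \<in> Z"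
proof -
  obtain Ps where Ps: "finite Ps" "\<And>p. p \<in> Ps \<Longrightarrow> pattern G B p"
    and Z: "Z = configs G B \<inter> (\<Inter>p\<in>Ps. avoiding G B p)"
    using assms unfolding SFT_def by blast
  define K where "K = (\<Union>p\<in>Ps. dom p)"
  have K: "finite K" "K \<subseteq> carrier G"
    using Ps unfolding K_def pattern_def by auto
  define L where "L = {d. \<exists>k\<in>K. \<exists>k'\<in>K. d = k \<otimes> inv k'}"
  have "finite L" "L \<subseteq> carrier G"
    using K by (auto simp: L_def intro!: finite_quotients m_closed)
  have glue: "(\<lambda>g. if g \<in> F then z g else z' g) \<in> Z" (is "?w \<in> Z")
    if z: "z \<in> Z" "z' \<in> Z" and
      eq: "\<And>c. c \<in> F \<Longrightarrow> c \<in> carrier G \<Longrightarrow> \<exists>l\<in>L. l \<otimes> c \<notin> F \<Longrightarrow> z c = z' c" for F z z'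
  proof -
    have "?w \<in> configs G B"
      using z unfolding Z configs_def by (auto simp: PiE_def Pi_def extensional_def)
    moreover have "?w \<in> avoiding G B p" if p: "p \<in> Ps" for p
    proof -
      have zp: "z \<in> avoiding G B p" "z' \<in> avoiding G B p" using z p unfolding Z by auto
      have "\<exists>h\<in>dom p. Some (?w (h \<otimes> g)) \<noteq> p h" if g: "g \<in> carrier G" for g
      proof (cases "\<forall>h\<in>dom p. h \<otimes> g \<in> F")
        case True
        then show ?thesis
          using zp(1) g unfolding avoiding_alt[OF Ps(2)[OF p]] by auto
      next
        case False
        then obtain k where k: "k \<in> dom p" "k \<otimes> g \<notin> F" by blast
        have kK: "k \<in> K" using k p unfolding K_def by blast
        have "?w (h \<otimes> g) = z' (h \<otimes> g)" if h: "h \<in> dom p" for h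
        proof -
          have hK: "h \<in> K" using h p unfolding K_def by blast
          have "k \<otimes> inv h \<otimes> (h \<otimes> g) = k \<otimes> g"
            using hK kK K g by (simp add: m_assoc inv_cancel subset_eq)
          then have "\<exists>l\<in>L. l \<otimes> (h \<otimes> g) \<notin> F"
            using hK kK k unfolding L_def by (intro bexI[of _ "k \<otimes> inv h"]) auto
          then show ?thesis using eq[of "h \<otimes> g"] hK K g by (auto simp: subset_eq)
        qed
        then show ?thesis
          using zp(2) g unfolding avoiding_alt[OF Ps(2)[OF p]] by auto
      qed
      then show ?thesis
        using \<open>?w \<in> configs G B\<close> unfolding avoiding_alt[OF Ps(2)[OF p]] by blast
    qed
    ultimately show ?thesis unfolding Z by blast
  qed
  from \<open>finite L\<close> \<open>L \<subseteq> carrier G\<close> show thesis by (rule that) (rule glue; blast)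
qed

text \<open>\<open>Y\<close> is only assumed to lie between the conflict-free configurations over 0
  to 4 and all conflict-free ones: the lower bound contains the separating configurations, the upper
  bound applies to the glued ones.\<close>

lemma (in group) not_sofic_if_conflict_free:
  assumes "amenable G" "subgroup H G" "infinite H"
    and Y1: "\<And>y. y \<in> configs G {..4} \<Longrightarrow> conflict_free G H y \<Longrightarrow> y \<in> Y"
    and Y2: "\<And>y. y \<in> Y \<Longrightarrow> conflict_free G H y"
  shows "\<not> sofic G A Y"
proof
  assume "sofic G A Y"
  then obtain B Z \<phi> where B: "finite (B :: nat set)" and SFT: "SFT G B Z"
    and Y: "Y = (\<lambda>y. \<lambda>g\<in>carrier G. \<phi> (y g)) ` Z"
    unfolding sofic_def by blast
  obtain L where L: "finite L" "L \<subseteq> carrier G"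
    and glue: "\<And>F z z'. z \<in> Z \<Longrightarrow> z' \<in> Z \<Longrightarrow>
      (\<And>c. c \<in> F \<Longrightarrow> c \<in> carrier G \<Longrightarrow> \<exists>l\<in>L. l \<otimes> c \<notin> F \<Longrightarrow> z c = z' c) \<Longrightarrow>
      (\<lambda>g. if g \<in> F then z g else z' g) \<in> Z"
    using SFT_glue[OF SFT] by blast
  \<comment> \<open>The factor \<open>card B\<close> suits the estimate
    \<open>card B ^ card S \<le> 2 ^ (card B * card S)\<close> that ends the count.\<close>
  obtain F where F: "finite F" "F \<subseteq> carrier G"
    and small: "card B * card {c \<in> F. \<exists>l\<in>L. l \<otimes> c \<notin> F} < card F"
    using exists_small_boundary[OF assms(1) L] by blast
  define S where "S = {c \<in> F. \<exists>l\<in>L. l \<otimes> c \<notin> F}"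
  obtain y where y: "\<And>P. P \<subseteq> F \<Longrightarrow> y P \<in> configs G {..4}"
    "\<And>P. P \<subseteq> F \<Longrightarrow> conflict_free G H (y P)"
    "\<And>P Q. P \<subseteq> F \<Longrightarrow> Q \<subseteq> F \<Longrightarrow>
      conflict_free G H (\<lambda>g. if g \<in> F then y P g else y Q g) \<Longrightarrow> P \<subseteq> Q"
    using exists_separating_configs[OF assms(2,3) F] by blast
  have "\<forall>P\<in>Pow F. \<exists>z\<in>Z. y P = (\<lambda>g\<in>carrier G. \<phi> (z g))"
    using Y1 y(1,2) unfolding Y by blast
  then obtain z where z: "\<And>P. P \<subseteq> F \<Longrightarrow> z P \<in> Z"
    "\<And>P. P \<subseteq> F \<Longrightarrow> y P = (\<lambda>g\<in>carrier G. \<phi> (z P g))"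
    by (metis PowI)
  \<comment> \<open>Equal values on the boundary \<open>S\<close> allow the preimage of
    \<open>y P\<close> on \<open>F\<close> to be continued by the preimage of \<open>y Q\<close>
    outside. The image of the result lies in \<open>Y\<close> and mixes \<open>y P\<close> with
    \<open>y Q\<close>.\<close>
  have separated: "P \<subseteq> Q" if PQ: "P \<subseteq> F" "Q \<subseteq> F" and eq: "restrict (z P) S = restrict (z Q) S" for P Q
  proof (rule y(3)[OF PQ])
    have "z P c = z Q c" if "c \<in> S" for c using eq that by (metis restrict_apply')
    then have "(\<lambda>g. if g \<in> F then z P g else z Q g) \<in> Z"
      using glue[OF z(1)[OF PQ(1)] z(1)[OF PQ(2)]] unfolding S_def by blast
    then have "(\<lambda>g\<in>carrier G. \<phi> (if g \<in> F then z P g else z Q g)) \<in> Y"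
      unfolding Y by (rule rev_image_eqI) simp
    moreover have "(\<lambda>g\<in>carrier G. \<phi> (if g \<in> F then z P g else z Q g))
        = (\<lambda>g. if g \<in> F then y P g else y Q g)"
      using F(2) unfolding z(2)[OF PQ(1)] z(2)[OF PQ(2)] by (auto simp: fun_eq_iff)
    ultimately show "conflict_free G H (\<lambda>g. if g \<in> F then y P g else y Q g)"
      using Y2 by metis
  qed
  have fin: "finite S" "S \<subseteq> carrier G" unfolding S_def using F by auto
  have "inj_on (\<lambda>P. restrict (z P) S) (Pow F)"
  proof (rule inj_onI)
    fix P Q assume "P \<in> Pow F" "Q \<in> Pow F" "restrict (z P) S = restrict (z Q) S"
    then show "P = Q" using separated[of P Q] separated[of Q P] by simp
  qed
  moreover have "(\<lambda>P. restrict (z P) S) ` Pow F \<subseteq> (S \<rightarrow>\<^sub>E B)"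
  proof -
    have "z P c \<in> B" if "P \<subseteq> F" "c \<in> S" for P c
      using z(1)[OF that(1)] SFT fin that(2) unfolding SFT_def configs_def by blast
    then show ?thesis by auto
  qed
  ultimately have "card (Pow F) \<le> card (S \<rightarrow>\<^sub>E B)"
    using fin B by (intro card_inj_on_le finite_PiE) auto
  then have "2 ^ card F \<le> card B ^ card S"
    using F fin by (simp add: card_Pow card_PiE)
  also have "\<dots> \<le> (2 ^ card B) ^ card S"
    by (intro power_mono less_imp_le[OF less_exp]) simp
  also have "\<dots> < 2 ^ card F"
    using small unfolding S_def by (simp flip: power_mult)
  finally show False by simp
qed

text \<open>The numbering \<open>\<nu>\<close> is universally quantified, so effectiveness is
  obtained with respect to every computable copy of \<open>H\<close>.\<close>

theorem mainTheorem1: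
  fixes G :: "('g, 'm) monoid_scheme" and H :: "'g set" and \<nu> :: "'g \<Rightarrow> nat"
  assumes "group G" and "countable (carrier G)" and "amenable G" and "decidable_word_problem G"
    and "subgroup H G" and "infinite H" and "computable_copy (G\<lparr>carrier := H\<rparr>) \<nu>"
  shows "\<exists>(A :: nat set) X. effective_subshift (G\<lparr>carrier := H\<rparr>) \<nu> A X \<and>
    \<not> sofic G A (induced_subshift G H A X)"
proof -
  interpret group G by fact
  have "group (G\<lparr>carrier := H\<rparr>)" using assms(5) by (rule subgroup_imp_group)
  then obtain X where X: "effective_subshift (G\<lparr>carrier := H\<rparr>) \<nu> {..5} X"
    "\<And>x. x \<in> configs (G\<lparr>carrier := H\<rparr>) {..4} \<Longrightarrow> conflict_free (G\<lparr>carrier := H\<rparr>) H x \<Longrightarrow> x \<in> X"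
    "\<And>x. x \<in> X \<Longrightarrow> conflict_free (G\<lparr>carrier := H\<rparr>) H x"
    using exists_effective_conflict_subshift[of "G\<lparr>carrier := H\<rparr>" \<nu>] assms(6,7) by auto
  have "\<not> sofic G {..5} (induced_subshift G H {..5} X)"
    using induced_subshift_conflict_free[OF assms(1,5) X(2,3)]
    by (rule not_sofic_if_conflict_free[OF assms(3,5,6)])
  with X(1) show ?thesis by blast
qed

end
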